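(* Let $n\in\mathbb N$, $\alpha>0$, $1<p<\infty$ and $\frac1p+\frac1{p'}=1$. For every $f\in\mathcal{H}^n_{p,\alpha}\setminus\{0\}$ and every multi-index $\mathbf j\in\mathbb N^n$, \[ \frac{|\langle f,z^{\mathbf j}\rangle_\alpha|}{\|f\|_{p,\alpha}}\le\frac{|\langle z^{\mathbf j},z^{\mathbf j}\rangle_\alpha|}{\|z^{\mathbf j}\|_{p,\alpha}}, \] equivalently $\mathcal{R}_{p,\alpha}(f,z^{\mathbf j})\le\mathcal{R}_{p,\alpha}(z^{\mathbf j},z^{\mathbf j})$, where $\mathcal{R}_{p,\alpha}(g,h)=\frac{|\langle g,h\rangle_\alpha|}{\|g\|_{p,\alpha}\|h\|_{p',\alpha}}$. Both inequalities are equalities if and only if $f(z)$ is a constant multiple of $z^{\mathbf j}$.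
   Context: For $\alpha>0$, $\gamma^n_\alpha(dz)=(\alpha/\pi)^n e^{-\alpha|z|^2}\lambda^n(dz)$ on $\mathbb C^n$, with $\lambda^n$ Lebesgue measure. For $1\le q<\infty$, $\mathcal{H}^n_{q,\alpha}$ is the space of holomorphic $f$ on $\mathbb C^n$ with $\|f\|_{q,\alpha}:=\left(\int|f|^q\,d\gamma^n_{\alpha q/2}\right)^{1/q}<\infty$. $\langle f,g\rangle_\alpha=\int f\overline g\,d\gamma^n_\alpha$. $z^{\mathbf j}=z_1^{j_1}\cdots z_n^{j_n}$. *)

theory Defs
  imports "HOL-Analysis.Analysis"
begin

text \<open>Points of C^n are modelled as vectors of type complex^'n, with n = CARD('n).
  Lebesgue measure on C^n = R^{2n} is lborel on this euclidean space.\<close>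

text \<open>Holomorphic on all of C^n: complex Frechet differentiable everywhere, i.e. the
  (real) derivative is complex-linear.\<close>
definition entire_n :: "(complex^'n \<Rightarrow> complex) \<Rightarrow> bool" where
  "entire_n f \<longleftrightarrow>
     (\<forall>z. \<exists>L. (f has_derivative L) (at z) \<and> (\<forall>c v. L (c *s v) = c * L v))"

definition gauss_dens :: "real \<Rightarrow> complex^'n \<Rightarrow> real" where
  "gauss_dens a z = (a / pi) ^ CARD('n) * exp (- a * (norm z)\<^sup>2)"

definition fock_norm :: "real \<Rightarrow> real \<Rightarrow> (complex^'n \<Rightarrow> complex) \<Rightarrow> real" where
  "fock_norm q a f =
     (\<integral>z. norm (f z) powr q * gauss_dens (a * q / 2) z \<partial>lborel) powr (1 / q)"

definition fock_space :: "real \<Rightarrow> real \<Rightarrow> (complex^'n \<Rightarrow> complex) set" where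
  "fock_space q a =
     {f. entire_n f \<and>
         integrable lborel (\<lambda>z. norm (f z) powr q * gauss_dens (a * q / 2) z)}"

definition fock_inner ::
  "real \<Rightarrow> (complex^'n \<Rightarrow> complex) \<Rightarrow> (complex^'n \<Rightarrow> complex) \<Rightarrow> complex" where
  "fock_inner a f g =
     (\<integral>z. f z * cnj (g z) * complex_of_real (gauss_dens a z) \<partial>lborel)"

definition monom_n :: "('n::finite \<Rightarrow> nat) \<Rightarrow> complex^'n \<Rightarrow> complex" where
  "monom_n j z = (\<Prod>i\<in>UNIV. (z $ i) ^ j i)"

definition fock_R ::
  "real \<Rightarrow> real \<Rightarrow> real \<Rightarrow> (complex^'n \<Rightarrow> complex) \<Rightarrow> (complex^'n \<Rightarrow> complex) \<Rightarrow> real" where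
  "fock_R p p' a g h = norm (fock_inner a g h) / (fock_norm p a g * fock_norm p' a h)"

end

theory Submission
  imports
    Defs
    "HOL-Probability.Distributions"
    "HOL-Complex_Analysis.Cauchy_Integral_Formula"
begin

text \<open>
  Write \<open>m\<close> for the monomial. Averaging \<open>f\<close> over the torus against the character of \<open>m\<close>
  turns \<open>f\<close> into \<open>c m\<close>, where \<open>c\<close> is a Taylor coefficient of \<open>f\<close>. As Lebesgue
  measure is invariant under the torus, \<open>\<integral> f cnj m w = c \<integral> |m|\<^sup>2 w\<close> for every torus-invariant
  weight \<open>w\<close> that makes the left side integrable. The Gaussian weight for \<open>a\<close> gives
  \<open>\<langle>f, m\<rangle> = c \<langle>m, m\<rangle>\<close>. The weight \<open>|m|\<^sup>p\<^sup>-\<^sup>2\<close> times the Gaussian for \<open>a p / 2\<close> makes the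
  linear term vanish when the tangent inequality
  \<open>|f|\<^sup>p \<ge> |c m|\<^sup>p + p |c m|\<^sup>p\<^sup>-\<^sup>2 (Re (f cnj (c m)) - |c m|\<^sup>2)\<close> is integrated, so that
  \<open>\<parallel>c m\<parallel> \<le> \<parallel>f\<parallel>\<close>. The tangent inequality is strict wherever \<open>f \<noteq> c m\<close>, which settles the
  case of equality.
\<close>

section \<open>Rotation invariance of Lebesgue measure\<close>

lemma distr_lborel_orthogonal_transformation:
  fixes T :: "'a::euclidean_space \<Rightarrow> 'a"
  assumes T: "orthogonal_transformation T"
  shows "distr lborel borel T = lborel"
proof -
  \<comment> \<open>Up to a null set a box is a disjoint union of balls, and \<open>T\<close> maps balls to balls of the same radius.\<close>
  have lin: "linear T" using T orthogonal_transformation_linear by blast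
  have bij: "bij T" using T orthogonal_transformation_bij by blast
  have T': "orthogonal_transformation (inv T)" using T orthogonal_transformation_inv by blast
  have lin': "linear (inv T)" using T' orthogonal_transformation_linear by blast
  have vimage: "T -` S = inv T ` S" for S
    using bij by (rule bij_vimage_eq_inv_image)
  have meas [measurable]: "T \<in> borel_measurable borel"
    using lin by (simp add: borel_measurable_continuous_onI linear_continuous_on linear_conv_bounded_linear)
  have "emeasure (distr lborel borel T) (box l u) = emeasure lborel (box l u)" for l u
  proof -
    let ?K = "{(x, r::real). 0 < r \<and> ball x r \<subseteq> box l u}"
    \<comment> \<open>Arbitrarily small admissible balls around every point: the fineness that the
      Vitali covering theorem asks for.\<close>
    have K: "\<exists>i. i \<in> ?K \<and> x \<in> ball (fst i) (snd i) \<and> snd i < d" if xd: "x \<in> box l u" "0 < d" for x d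
    proof -
      obtain e where "e > 0" "ball x e \<subseteq> box l u"
        using openE[OF open_box xd(1)] by blast
      then have "(x, min e (d / 2)) \<in> ?K" using xd by auto
      then show ?thesis using xd \<open>e > 0\<close> by (intro exI[of _ "(x, min e (d/2))"]) auto
    qed
    obtain C where C: "countable C" "C \<subseteq> ?K"
        "pairwise (\<lambda>i j. disjnt (ball (fst i) (snd i)) (ball (fst j) (snd j))) C"
        "negligible (box l u - (\<Union>i\<in>C. ball (fst i) (snd i)))"
      by (rule Vitali_covering_theorem_balls[OF K])
    let ?B = "\<lambda>i. ball (fst i) (snd i :: real) :: 'a set"
    let ?N = "box l u - (\<Union>i\<in>C. ?B i)"
    have "?B i \<subseteq> box l u" if "i \<in> C" for i
      using subsetD[OF C(2) that] by (simp add: case_prod_beta)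
    then have box_eq: "box l u = (\<Union>i\<in>C. ?B i) \<union> ?N" by blast
    have disj: "disjoint_family_on ?B C"
      using C(3) by (auto simp: pairwise_def disjoint_family_on_def disjnt_def)
    have Nb: "?N \<in> sets borel" by (intro sets.Diff borel_open open_UN) auto
    then have N0: "?N \<in> null_sets lborel"
      using C(4) by (simp add: negligible_iff_null_sets null_sets_completion_iff)
    \<comment> \<open>\<open>inv T\<close> is an isometry, hence Lipschitz with constant 1, and so
      keeps null sets null. Preservation of measure is still to be shown and cannot be used
      here.\<close>
    have "negligible (inv T ` ?N)"
    proof (rule negligible_locally_Lipschitz_image)
      show "\<exists>U B. open U \<and> x \<in> U \<and> (\<forall>y\<in>?N \<inter> U. norm (inv T y - inv T x) \<le> B * norm (y - x))" for x
        using T' by (intro exI[of _ UNIV] exI[of _ 1])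
          (simp add: orthogonal_transformation_norm flip: linear_diff[OF lin'])
    qed (use C in auto)
    moreover have "inv T ` ?N \<in> sets borel"
      unfolding vimage[symmetric] using measurable_sets[OF meas Nb] by simp
    ultimately have N0': "T -` ?N \<in> null_sets lborel"
      unfolding vimage by (simp add: negligible_iff_null_sets null_sets_completion_iff)
    have ball: "T -` ?B i = ball (inv T (fst i)) (snd i)" for i
      unfolding vimage using T' image_orthogonal_transformation_ball by blast
    have 1: "emeasure lborel (box l u) = (\<integral>\<^sup>+i. emeasure lborel (?B i) \<partial>count_space C)"
    proof -
      have "emeasure lborel (box l u) = emeasure lborel (\<Union>i\<in>C. ?B i)"
        by (subst box_eq, rule emeasure_Un_null_set) (use N0 in \<open>auto intro!: borel_open open_UN\<close>)
      also have "\<dots> = (\<integral>\<^sup>+i. emeasure lborel (?B i) \<partial>count_space C)"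
        by (rule emeasure_UN_countable) (use C disj in auto)
      finally show ?thesis .
    qed
    have 2: "emeasure lborel (T -` box l u) = (\<integral>\<^sup>+i. emeasure lborel (T -` ?B i) \<partial>count_space C)"
    proof -
      have "T -` box l u = (\<Union>i\<in>C. T -` ?B i) \<union> T -` ?N"
        by (subst box_eq) auto
      then have "emeasure lborel (T -` box l u) = emeasure lborel (\<Union>i\<in>C. T -` ?B i)"
      proof (simp only:, intro emeasure_Un_null_set)
        show "(\<Union>i\<in>C. T -` ?B i) \<in> sets lborel" by (auto simp: ball intro!: borel_open open_UN)
        show "T -` ?N \<in> null_sets lborel" by (rule N0')
      qed
      also have "\<dots> = (\<integral>\<^sup>+i. emeasure lborel (T -` ?B i) \<partial>count_space C)"
      proof (rule emeasure_UN_countable)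
        show "disjoint_family_on (\<lambda>i. T -` ?B i) C"
          using disj by (auto simp: disjoint_family_on_def simp flip: vimage_Int)
      qed (use C in \<open>auto simp: ball\<close>)
      finally show ?thesis .
    qed
    have "emeasure lborel (T -` ?B i) = emeasure lborel (?B i)" if "i \<in> C" for i
      using that C(2) unfolding ball by (subst (1 2) emeasure_ball) auto
    then have "emeasure lborel (T -` box l u) = emeasure lborel (box l u)"
      unfolding 1 2 by (intro nn_integral_cong) auto
    then show ?thesis by (simp add: emeasure_distr)
  qed
  then show ?thesis
    by (intro lborel_eqI[symmetric]) (simp_all add: emeasure_lborel_box)
qed

section \<open>Rotations of a single coordinate\<close>

text \<open>One unit of \<open>t\<close> is a full turn, as in the parametrisation of
  \<open>circlepath\<close>, so averages run over \<open>{0..1}\<close> with total mass one.\<close>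

definition rot :: "'n \<Rightarrow> real \<Rightarrow> complex^'n \<Rightarrow> complex^'n" where
  "rot k t z = (\<chi> i. if i = k then cis (2 * pi * t) * z $ i else z $ i)"

lemma rot_nth: "rot k t z $ i = (if i = k then cis (2 * pi * t) * z $ i else z $ i)"
  by (simp add: rot_def)

lemma inner_cis_mult: "inner (cis s * x) (cis s * y) = inner x y"
proof -
  have "(cos s)\<^sup>2 + (sin s)\<^sup>2 = 1" by simp
  then show ?thesis
    unfolding inner_complex_def times_complex.sel cis.sel by algebra
qed

lemma orthogonal_transformation_rot: "orthogonal_transformation (rot k t :: complex^'n \<Rightarrow> _)"
proof -
  have "linear (rot k t :: complex^'n \<Rightarrow> _)"
    by (rule linearI) (auto simp: vec_eq_iff rot_nth algebra_simps)
  moreover have "inner (rot k t v) (rot k t w) = inner v w" for v w :: "complex^'n"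
    by (auto simp: inner_vec_def rot_nth inner_cis_mult intro!: sum.cong)
  ultimately show ?thesis by (simp add: orthogonal_transformation_def)
qed

lemma norm_rot [simp]: "norm (rot k t z) = norm z"
  using orthogonal_transformation_rot orthogonal_transformation_norm by blast

lemma monom_n_rot: "monom_n j (rot k t z) = cis (2 * pi * real (j k) * t) * monom_n j z"
proof -
  have pow: "cis (2 * pi * t) ^ j k = cis (2 * pi * real (j k) * t)"
    by (subst Complex.DeMoivre) (simp add: mult_ac)
  have "monom_n j (rot k t z) = (\<Prod>i\<in>UNIV. (if i = k then cis (2 * pi * real (j k) * t) else 1) * (z $ i) ^ j i)"
    unfolding monom_n_def
    by (intro prod.cong) (auto simp: rot_nth power_mult_distrib pow)
  also have "\<dots> = cis (2 * pi * real (j k) * t) * monom_n j z"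
    by (simp add: prod.distrib monom_n_def)
  finally show ?thesis .
qed

lemma continuous_on_rot [continuous_intros]:
  assumes "continuous_on S t" "continuous_on S (z :: 'a::topological_space \<Rightarrow> complex^'n)"
  shows "continuous_on S (\<lambda>x. rot k (t x) (z x))"
  unfolding rot_def
proof (rule continuous_on_vec_lambda)
  show "continuous_on S (\<lambda>x. if i = k then cis (2 * pi * t x) * z x $ i else z x $ i)" for i
    using assms by (cases "i = k") (auto intro!: continuous_intros)
qed

lemma
  fixes g :: "complex^'n \<Rightarrow> 'b::{banach, second_countable_topology}"
  assumes [measurable]: "g \<in> borel_measurable borel"
  shows integrable_rot_iff: "integrable lborel (\<lambda>z. g (rot k t z)) \<longleftrightarrow> integrable lborel g"
    and integral_rot: "(\<integral>z. g (rot k t z) \<partial>lborel) = (\<integral>z. g z \<partial>lborel)"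
proof -
  have meas: "rot k t \<in> measurable lborel borel"
    by (simp add: borel_measurable_continuous_onI continuous_on_rot)
  have distr: "distr lborel borel (rot k t) = (lborel :: (complex^'n) measure)"
    by (rule distr_lborel_orthogonal_transformation[OF orthogonal_transformation_rot])
  show "integrable lborel (\<lambda>z. g (rot k t z)) \<longleftrightarrow> integrable lborel g"
    using integrable_distr_eq[OF meas assms] distr by simp
  show "(\<integral>z. g (rot k t z) \<partial>lborel) = (\<integral>z. g z \<partial>lborel)"
    using integral_distr[OF meas assms] distr by simp
qed

section \<open>Torus averages\<close>

text \<open>Cauchy's formula for the \<open>k\<close>-th derivative at 0 of
  \<open>u \<mapsto> h (\<zeta> * u)\<close> on the unit circle. Putting \<open>\<zeta>\<close> into
  the function and not into the contour also covers \<open>\<zeta> = 0\<close>; the chain rule then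
  brings out \<open>\<zeta> ^ k\<close>.\<close>

lemma circle_average:
  assumes "h holomorphic_on UNIV"
  shows "integral {0..1} (\<lambda>t. h (cis (2 * pi * t) * \<zeta>) * cis (- (2 * pi * real k * t)))
           = \<zeta> ^ k * ((deriv ^^ k) h 0 / fact k)"
proof -
  let ?h = "\<lambda>u. h (\<zeta> * u)"
  have hol: "?h holomorphic_on UNIV"
    using holomorphic_on_compose_gen[of "\<lambda>u. \<zeta> * u" UNIV h UNIV] assms
    by (auto simp: o_def intro!: holomorphic_intros)
  have "((\<lambda>u. ?h u / (u - 0) ^ Suc k) has_contour_integral
      (2 * pi * \<i>) / fact k * (deriv ^^ k) ?h 0) (circlepath 0 1)"
    by (rule Cauchy_has_contour_integral_higher_derivative_circlepath)
       (use hol in \<open>auto intro: holomorphic_on_imp_continuous_on holomorphic_on_subset\<close>)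
  then have "((\<lambda>t. ?h (circlepath 0 1 t) / circlepath 0 1 t ^ Suc k
        * vector_derivative (circlepath 0 1) (at t within {0..1})) has_integral
      (2 * pi * \<i>) / fact k * (deriv ^^ k) ?h 0) {0..1}"
    by (simp add: has_contour_integral_def)
  then have "((\<lambda>t. (2 * pi * \<i>) * (h (cis (2 * pi * t) * \<zeta>) * cis (- (2 * pi * real k * t)))) has_integral
      (2 * pi * \<i>) * ((deriv ^^ k) ?h 0 / fact k)) {0..1}"
  proof (rule has_integral_eq[rotated, THEN has_integral_eq_rhs])
    fix t :: real assume t: "t \<in> {0..1}"
    have e: "exp (2 * complex_of_real pi * \<i> * complex_of_real t) = cis (2 * pi * t)"
      by (simp add: cis_conv_exp mult_ac)
    have pow: "cis (2 * pi * t) ^ k * cis (- (2 * pi * real k * t)) = 1"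
      by (subst Complex.DeMoivre) (simp add: cis_mult mult_ac)
    have inv: "cis (- (2 * pi * real k * t)) = 1 / cis (2 * pi * t) ^ k"
      using pow by (simp add: field_simps)
    have c: "circlepath 0 1 t = cis (2 * pi * t)"
      unfolding circlepath e by simp
    have v: "vector_derivative (circlepath 0 1) (at t within {0..1}) = 2 * pi * \<i> * cis (2 * pi * t)"
      using t vector_derivative_circlepath01[of t 0 1] e by (simp add: mult_ac)
    \<comment> \<open>One of the \<open>Suc k\<close> factors of the denominator cancels the
      \<open>cis\<close> in the velocity of the circle; the other \<open>k\<close> form the
      character.\<close>
    show "?h (circlepath 0 1 t) / circlepath 0 1 t ^ Suc k
        * vector_derivative (circlepath 0 1) (at t within {0..1})
      = (2 * pi * \<i>) * (h (cis (2 * pi * t) * \<zeta>) * cis (- (2 * pi * real k * t)))"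
      unfolding c v inv by (simp add: mult.commute)
  qed simp
  then have "((\<lambda>t. h (cis (2 * pi * t) * \<zeta>) * cis (- (2 * pi * real k * t))) has_integral
      (deriv ^^ k) ?h 0 / fact k) {0..1}"
    by (subst (asm) has_integral_mult_right_iff) auto
  moreover have "(deriv ^^ k) ?h 0 = \<zeta> ^ k * (deriv ^^ k) h (\<zeta> * 0)"
    by (rule higher_deriv_compose_linear[of h UNIV UNIV]) (use assms in auto)
  ultimately show ?thesis by (simp add: integral_unique)
qed

section \<open>Slices and averages in one coordinate\<close>

definition upd :: "'n \<Rightarrow> complex \<Rightarrow> complex^'n \<Rightarrow> complex^'n" where
  "upd k w z = (\<chi> i. if i = k then w else z $ i)"

lemma upd_nth: "upd k w z $ i = (if i = k then w else z $ i)"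
  by (simp add: upd_def)

lemma upd_upd: "upd k v (upd k w z) = upd k v z"
  by (simp add: vec_eq_iff upd_nth)

lemma rot_eq_upd: "rot k t z = upd k (cis (2 * pi * t) * z $ k) z"
  by (simp add: vec_eq_iff upd_nth rot_nth)

lemma rot_upd: "i \<noteq> k \<Longrightarrow> rot k t (upd i w z) = upd i w (rot k t z)"
  by (auto simp: vec_eq_iff upd_nth rot_nth)

lemma rot_commute: "rot i s (rot k t z) = rot k t (rot i s z)"
  by (auto simp: vec_eq_iff rot_nth)

lemma entire_n_continuous: "entire_n f \<Longrightarrow> continuous_on S f"
  unfolding entire_n_def
  by (meson continuous_at_imp_continuous_on has_derivative_continuous)

text \<open>The slice is an affine map along a coordinate axis followed by \<open>f\<close>. Complex
  linearity of the derivative of \<open>f\<close> turns the real derivative of the composite into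
  multiplication by a complex number.\<close>

lemma entire_n_upd_holomorphic:
  assumes "entire_n f"
  shows "(\<lambda>w. f (upd k w z)) holomorphic_on UNIV"
proof -
  have "\<exists>d. ((\<lambda>w. f (upd k w z)) has_field_derivative d) (at w)" for w
  proof -
    obtain L where L: "(f has_derivative L) (at (upd k w z))" "\<And>c v. L (c *s v) = c * L v"
      using assms unfolding entire_n_def by blast
    define y where "y = upd k 0 z"
    have upd: "upd k v z = v *s axis k 1 + y" for v
      by (auto simp: vec_eq_iff upd_nth axis_def y_def)
    have "linear (\<lambda>v::complex. v *s (axis k 1 :: complex^'a))"
      by (rule linearI) (auto simp: vec_eq_iff algebra_simps)
    then have "((\<lambda>v. v *s (axis k 1 :: complex^'a)) has_derivative (\<lambda>v. v *s axis k 1)) (at w)"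
      by (simp add: linear_conv_bounded_linear bounded_linear_imp_has_derivative)
    then have "((\<lambda>v. upd k v z) has_derivative (\<lambda>v. v *s axis k 1)) (at w)"
      unfolding upd by (auto intro!: derivative_eq_intros)
    from diff_chain_at[OF this L(1)] have "((\<lambda>v. f (upd k v z)) has_derivative (\<lambda>v. v * L (axis k 1))) (at w)"
      by (simp add: o_def L(2))
    moreover have "(\<lambda>v. v * L (axis k 1)) = (*) (L (axis k 1))"
      by (auto simp: mult.commute)
    ultimately show ?thesis
      unfolding has_field_derivative_def by (intro exI[of _ "L (axis k 1)"]) simp
  qed
  then show ?thesis
    by (simp add: holomorphic_on_def field_differentiable_def)
qed

text \<open>The projection onto the functions that have weight \<open>j k\<close> under rotation of coordinate \<open>k\<close>.\<close>

definition avg :: "('n \<Rightarrow> nat) \<Rightarrow> 'n \<Rightarrow> (complex^'n \<Rightarrow> complex) \<Rightarrow> complex^'n \<Rightarrow> complex" where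
  "avg j k F z = integral {0..1} (\<lambda>t. F (rot k t z) * cis (- (2 * pi * real (j k) * t)))"

text \<open>Says that \<open>F\<close> is a power of \<open>z $ k\<close> times a function of the
  other coordinates, read off at \<open>z $ k = 1\<close>. This is stronger than having weight
  \<open>j k\<close> under rotation, which would leave the dependence on the modulus of
  \<open>z $ k\<close> open.\<close>

definition homog :: "('n \<Rightarrow> nat) \<Rightarrow> 'n \<Rightarrow> (complex^'n \<Rightarrow> complex) \<Rightarrow> bool" where
  "homog j k F \<longleftrightarrow> (\<forall>z. F z = (z $ k) ^ j k * F (upd k 1 z))"

text \<open>By \<open>circle_average\<close> on the slice, the average is a power of
  \<open>z $ k\<close> times a Taylor coefficient of that slice, and the slice does not see
  \<open>z $ k\<close>.\<close>

lemma homog_avg: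
  assumes "entire_n f"
  shows "homog j k (avg j k f)"
proof -
  have "avg j k f z = (z $ k) ^ j k * ((deriv ^^ j k) (\<lambda>w. f (upd k w z)) 0 / fact (j k))" for z
    unfolding avg_def rot_eq_upd
    by (rule circle_average[OF entire_n_upd_holomorphic[OF assms]])
  then show ?thesis by (simp add: homog_def upd_upd upd_nth)
qed

text \<open>Rotating coordinate \<open>k\<close> fixes coordinate \<open>i\<close>, so the power of
  \<open>z $ i\<close> is a constant under the integral.\<close>

lemma homog_avg_other:
  assumes "homog j i F" "i \<noteq> k"
  shows "homog j i (avg j k F)"
  unfolding homog_def
proof
  fix z
  have "F (rot k t z) = (z $ i) ^ j i * F (rot k t (upd i 1 z))" for t
    using assms unfolding homog_def by (metis rot_nth rot_upd)
  then show "avg j k F z = (z $ i) ^ j i * avg j k F (upd i 1 z)"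
    unfolding avg_def by (simp add: mult.assoc)
qed

lemma continuous_on_avg:
  assumes "continuous_on UNIV F"
  shows "continuous_on UNIV (avg j k F)"
proof -
  have "continuous_on (UNIV \<times> cbox 0 1) (\<lambda>(z, t). F (rot k t z) * cis (- (2 * pi * real (j k) * t)))"
    unfolding case_prod_beta
    by (intro continuous_intros continuous_on_compose2[OF assms]) auto
  from integral_continuous_on_param[OF this] show ?thesis
    unfolding avg_def[abs_def] by simp
qed

text \<open>Rotations of coordinates commute, and for a continuous integrand the two integrals over
  the unit square may be swapped.\<close>

lemma avg_commute:
  assumes "continuous_on UNIV F"
  shows "avg j i (avg j k F) = avg j k (avg j i F)"
proof
  fix z
  let ?f = "\<lambda>s t. F (rot k t (rot i s z)) * cis (- (2 * pi * real (j k) * t)) * cis (- (2 * pi * real (j i) * s))"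
  have "continuous_on (cbox (0,0) (1,1)) (\<lambda>(s, t). ?f s t)"
    unfolding case_prod_beta
    by (intro continuous_intros continuous_on_compose2[OF assms]) auto
  from integral_swap_continuous[OF this]
  have "integral {0..1} (\<lambda>s. integral {0..1} (?f s)) = integral {0..1} (\<lambda>t. integral {0..1} (\<lambda>s. ?f s t))"
    by simp
  also have "\<dots> = avg j k (avg j i F) z"
  proof -
    have "?f s t = F (rot i s (rot k t z)) * cis (- (2 * pi * real (j i) * s)) * cis (- (2 * pi * real (j k) * t))" for s t
      by (simp add: rot_commute[of k])
    then show ?thesis unfolding avg_def by (simp only: integral_mult_left)
  qed
  finally show "avg j i (avg j k F) z = avg j k (avg j i F) z"
    unfolding avg_def by simp
qed

lemma continuous_on_foldr_avg:
  "continuous_on UNIV F \<Longrightarrow> continuous_on UNIV (foldr (avg j) ks F)"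
  by (induction ks) (auto intro: continuous_on_avg)

lemma foldr_avg_commute:
  "continuous_on UNIV F \<Longrightarrow> avg j k (foldr (avg j) ks F) = foldr (avg j) ks (avg j k F)"
proof (induction ks)
  case (Cons i ks)
  then show ?case
    using avg_commute[of "foldr (avg j) ks F" j k i] by (simp add: continuous_on_foldr_avg)
qed simp

lemma homog_foldr_avg_other:
  "homog j k F \<Longrightarrow> k \<notin> set ks \<Longrightarrow> homog j k (foldr (avg j) ks F)"
  by (induction ks) (auto intro: homog_avg_other)

text \<open>\<open>homog_avg\<close> asks for an entire function, while averages are only shown to
  be continuous. The average in \<open>k\<close> is therefore commuted to the innermost place, where
  it meets \<open>f\<close> itself; the outer ones act on other coordinates and keep the
  homogeneity.\<close>

lemma homog_foldr_avg:
  assumes "entire_n f" "distinct ks" "k \<in> set ks"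
  shows "homog j k (foldr (avg j) ks f)"
  using assms(2,3)
proof (induction ks)
  case (Cons i ks)
  show ?case
  proof (cases "k = i")
    case True
    then have "homog j k (foldr (avg j) ks (avg j k f))"
      using Cons.prems assms(1) by (auto intro!: homog_foldr_avg_other homog_avg)
    then show ?thesis
      using True by (simp add: foldr_avg_commute entire_n_continuous assms(1))
  next
    case False
    then show ?thesis using Cons by (auto intro: homog_avg_other)
  qed
qed simp

text \<open>Homogeneity in \<open>k\<close> replaces \<open>z $ k\<close> by 1 at the cost of its
  power. Induction over the set \<open>S\<close> of coordinates already replaced collects all the
  powers.\<close>

lemma homog_all_imp_monom_n:
  fixes F :: "complex^'n \<Rightarrow> complex"
  assumes "\<And>k. homog j k F"
  shows "F z = F (\<chi> i. 1) * monom_n j z"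
proof -
  have "F z = (\<Prod>i\<in>S. (z $ i) ^ j i) * F (\<chi> i. if i \<in> S then 1 else z $ i)" if "finite S" for S
    using that
  proof (induction S)
    case empty
    have "(\<chi> i. z $ i) = z" by (simp add: vec_eq_iff)
    then show ?case by simp
  next
    case (insert k S)
    let ?y = "\<chi> i. if i \<in> S then 1 else z $ i"
    have "upd k 1 ?y = (\<chi> i. if i \<in> insert k S then 1 else z $ i)"
      by (auto simp: vec_eq_iff upd_nth)
    moreover have "F ?y = (?y $ k) ^ j k * F (upd k 1 ?y)"
      using assms[of k] unfolding homog_def by blast
    ultimately have "F ?y = (z $ k) ^ j k * F (\<chi> i. if i \<in> insert k S then 1 else z $ i)"
      using insert.hyps by simp
    then show ?case using insert by (simp add: mult_ac)
  qed
  from this[of UNIV] show ?thesis by (simp add: monom_n_def mult.commute)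
qed

lemma foldr_avg_eq_monom_n:
  fixes f :: "complex^'n \<Rightarrow> complex"
  assumes "entire_n f" "distinct ks" "set ks = UNIV"
  shows "foldr (avg j) ks f z = foldr (avg j) ks f (\<chi> i. 1) * monom_n j z"
  by (rule homog_all_imp_monom_n, rule homog_foldr_avg) (use assms in auto)

section \<open>Averages under the integral sign\<close>

text \<open>Fubini on \<open>{0..1}\<close> times the whole space, for the integrand composed with
  the rotations. Integrating over \<open>z\<close> first gives the original integral by rotation
  invariance; integrating over \<open>t\<close> first gives the integrand of the average.\<close>

lemma
  fixes F :: "complex^'n \<Rightarrow> complex" and w :: "complex^'n \<Rightarrow> real"
  assumes F: "continuous_on UNIV F"
    and w: "w \<in> borel_measurable borel" "\<And>t z. w (rot k t z) = w z"
    and int: "integrable lborel (\<lambda>z. F z * cnj (monom_n j z) * of_real (w z))"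
  shows integrable_avg: "integrable lborel (\<lambda>z. avg j k F z * cnj (monom_n j z) * of_real (w z))"
    and integral_avg: "(\<integral>z. avg j k F z * cnj (monom_n j z) * of_real (w z) \<partial>lborel)
        = (\<integral>z. F z * cnj (monom_n j z) * of_real (w z) \<partial>lborel)"
proof -
  define \<Phi> where "\<Phi> z = F z * cnj (monom_n j z) * of_real (w z)" for z
  define H where "H t z = indicator {0..1} t *\<^sub>R \<Phi> (rot k t z)" for t :: real and z
  have meas_\<Phi>: "\<Phi> \<in> borel_measurable borel" and int_\<Phi>: "integrable lborel \<Phi>"
    using int by (auto simp: \<Phi>_def[abs_def] dest: borel_measurable_integrable)
  have "(\<lambda>x. rot k (fst x) (snd x)) \<in> borel_measurable (borel :: (real \<times> (complex^'n)) measure)"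
    by (intro borel_measurable_continuous_onI continuous_intros)
  then have meas_rot: "(\<lambda>x. rot k (fst x) (snd x)) \<in> borel_measurable (lborel \<Otimes>\<^sub>M (lborel :: (complex^'n) measure))"
    by (simp add: lborel_prod)
  have meas_H: "case_prod H \<in> borel_measurable (lborel \<Otimes>\<^sub>M lborel)"
    unfolding H_def case_prod_beta
    by (intro borel_measurable_scaleR measurable_compose[OF meas_rot meas_\<Phi>]) measurable
  \<comment> \<open>The inner integral of the norm is the same for every \<open>t\<close> in
    \<open>{0..1}\<close>, so the iterated integral is finite and Fubini applies.\<close>
  have "(\<integral>z. norm (H t z) \<partial>lborel) = indicator {0..1} t * (\<integral>z. norm (\<Phi> z) \<partial>lborel)" for t
    using integral_rot[of "\<lambda>z. norm (\<Phi> z)" k t] meas_\<Phi> by (simp add: H_def)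
  moreover have "integrable lborel (indicator {0..1::real} :: real \<Rightarrow> real)" by simp
  ultimately have H1: "integrable lborel (\<lambda>t. \<integral>z. norm (H t z) \<partial>lborel)"
    by (simp only: integrable_mult_left)
  have "integrable (lborel \<Otimes>\<^sub>M lborel) (case_prod H)"
    by (rule lborel_pair.Fubini_integrable[OF meas_H])
       (use H1 int_\<Phi> integrable_rot_iff[OF meas_\<Phi>] in \<open>auto simp: H_def[abs_def]\<close>)
  note H = lborel_pair.integrable_snd[OF this] lborel_pair.Fubini_integral[OF this]
  have "(\<integral>t. H t z \<partial>lborel) = avg j k F z * cnj (monom_n j z) * of_real (w z)" for z
  proof -
    let ?G = "\<lambda>t. F (rot k t z) * cis (- (2 * pi * real (j k) * t))"
    have "continuous_on {0..1} ?G"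
      by (intro continuous_intros continuous_on_compose2[OF F]) auto
    then have "set_integrable lborel {0..1} ?G" by (rule borel_integrable_atLeastAtMost')
    from set_borel_integral_eq_integral(2)[OF this]
    have "(\<integral>t. indicator {0..1} t *\<^sub>R ?G t \<partial>lborel) = avg j k F z"
      by (simp add: set_lebesgue_integral_def avg_def)
    \<comment> \<open>Rotating the conjugated monomial produces exactly the character in
      \<open>avg\<close>, while \<open>w\<close> stays fixed.\<close>
    moreover have "H t z = (indicator {0..1} t *\<^sub>R ?G t) * (cnj (monom_n j z) * of_real (w z))" for t
      by (simp add: H_def \<Phi>_def monom_n_rot w(2) cis_cnj mult_ac)
    ultimately show ?thesis by (simp only: integral_mult_left_zero mult.assoc)
  qed
  moreover have "(\<integral>t. (\<integral>z. H t z \<partial>lborel) \<partial>lborel) = (\<integral>z. \<Phi> z \<partial>lborel)"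
    unfolding H_def using integral_rot[OF meas_\<Phi>] by simp
  ultimately show "integrable lborel (\<lambda>z. avg j k F z * cnj (monom_n j z) * of_real (w z))"
    "(\<integral>z. avg j k F z * cnj (monom_n j z) * of_real (w z) \<partial>lborel)
        = (\<integral>z. F z * cnj (monom_n j z) * of_real (w z) \<partial>lborel)"
    using H by (simp_all add: \<Phi>_def)
qed

text \<open>The constant is obtained before the weight: a single coefficient serves every invariant
  weight, and this is what ties the inner product to the norm.\<close>

lemma integral_entire_n_cnj_monom_n:
  fixes f :: "complex^'n \<Rightarrow> complex"
  assumes "entire_n f"
  obtains c where "\<And>w. \<lbrakk>w \<in> borel_measurable borel; \<And>k t z. w (rot k t z) = w z;
      integrable lborel (\<lambda>z. f z * cnj (monom_n j z) * of_real (w z))\<rbrakk>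
    \<Longrightarrow> (\<integral>z. f z * cnj (monom_n j z) * of_real (w z) \<partial>lborel)
          = c * of_real (\<integral>z. (norm (monom_n j z))\<^sup>2 * w z \<partial>lborel)"
proof -
  obtain ks :: "'n list" where ks: "set ks = UNIV" "distinct ks"
    using finite_distinct_list[OF finite[of "UNIV :: 'n set"]] by blast
  \<comment> \<open>The full torus average is a multiple of the monomial, and the monomial is 1 at
    this point.\<close>
  let ?c = "foldr (avg j) ks f (\<chi> i. 1)"
  have "(\<integral>z. f z * cnj (monom_n j z) * of_real (w z) \<partial>lborel)
          = ?c * of_real (\<integral>z. (norm (monom_n j z))\<^sup>2 * w z \<partial>lborel)"
    if w: "w \<in> borel_measurable borel" "\<And>k t z. w (rot k t z) = w z"
      "integrable lborel (\<lambda>z. f z * cnj (monom_n j z) * of_real (w z))" for w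
  proof -
    let ?I = "\<lambda>F z. F z * cnj (monom_n j z) * of_real (w z)"
    have "integrable lborel (?I (foldr (avg j) xs f)) \<and>
        (\<integral>z. ?I (foldr (avg j) xs f) z \<partial>lborel) = (\<integral>z. ?I f z \<partial>lborel)" for xs
    proof (induction xs)
      case (Cons k xs)
      have "continuous_on UNIV (foldr (avg j) xs f)"
        by (intro continuous_on_foldr_avg entire_n_continuous assms)
      note * = integrable_avg[OF this w(1,2)] integral_avg[OF this w(1,2)]
      show ?case using Cons *[of j] by simp
    qed (use w in simp)
    then have "(\<integral>z. ?I f z \<partial>lborel) = (\<integral>z. ?I (foldr (avg j) ks f) z \<partial>lborel)" by simp
    also have "\<dots> = (\<integral>z. ?c * of_real ((norm (monom_n j z))\<^sup>2 * w z) \<partial>lborel)"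
    proof (rule Bochner_Integration.integral_cong[OF refl])
      fix z
      show "?I (foldr (avg j) ks f) z = ?c * of_real ((norm (monom_n j z))\<^sup>2 * w z)"
        by (subst foldr_avg_eq_monom_n[OF assms ks(2,1)])
           (simp add: complex_norm_square mult_ac del: of_real_power flip: of_real_power)
    qed
    also have "\<dots> = ?c * of_real (\<integral>z. (norm (monom_n j z))\<^sup>2 * w z \<partial>lborel)"
      by (simp only: integral_mult_right_zero integral_complex_of_real)
    finally show ?thesis .
  qed
  then show thesis by (rule that)
qed

section \<open>Integrability\<close>

lemma integrable_exp_minus_norm_squared:
  fixes b :: real
  assumes "b > 0"
  shows "integrable lborel (\<lambda>z::'a::euclidean_space. exp (- b * (norm z)\<^sup>2))"
proof -
  interpret product_sigma_finite "\<lambda>_::'a. lborel :: real measure" ..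
  have "integrable lborel (\<lambda>x. exp (- b * x\<^sup>2) :: real)"
  proof -
    \<comment> \<open>The standard deviation for which the normal density has exponent
      \<open>- b * x\<^sup>2\<close>.\<close>
    define s where "s = 1 / sqrt (2 * b)"
    have s: "s > 0" "s\<^sup>2 = 1 / (2 * b)" using assms by (auto simp: s_def power_divide)
    have "(\<lambda>x. sqrt (2 * pi * s\<^sup>2) * normal_density 0 s x) = (\<lambda>x. exp (- b * x\<^sup>2))"
      using s assms by (auto simp: normal_density_def)
    then show ?thesis
      using integrable_mult_right[OF integrable_normal_density[OF s(1), of 0], of "sqrt (2 * pi * s\<^sup>2)"] by simp
  qed
  then have "integrable (\<Pi>\<^sub>M i\<in>(Basis::'a set). lborel) (\<lambda>x. \<Prod>i\<in>Basis. exp (- b * (x i)\<^sup>2) :: real)"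
    by (intro product_integrable_prod) auto
  moreover have "(\<Prod>i\<in>Basis. exp (- b * (x i)\<^sup>2)) = exp (- b * (norm (\<Sum>i\<in>Basis. x i *\<^sub>R i :: 'a))\<^sup>2)" for x
  proof -
    have "(norm (\<Sum>i\<in>Basis. x i *\<^sub>R i :: 'a))\<^sup>2 = (\<Sum>i\<in>Basis. (x i)\<^sup>2)"
      by (subst power2_norm_eq_inner, subst euclidean_inner) (simp add: power2_eq_square)
    then show ?thesis by (simp add: sum_distrib_left sum_negf flip: exp_sum)
  qed
  ultimately show ?thesis
    by (subst lborel_eq) (simp add: integrable_distr_eq)
qed

lemma norm_monom_n_le: "norm (monom_n j z) \<le> norm z ^ (\<Sum>i\<in>UNIV. j i)"
proof -
  have "norm (monom_n j z) = (\<Prod>i\<in>UNIV. norm (z $ i) ^ j i)"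
    by (simp add: monom_n_def prod_norm norm_power flip: prod_norm)
  also have "\<dots> \<le> (\<Prod>i\<in>UNIV. norm z ^ j i)"
    by (intro prod_mono conjI power_mono) (auto simp: Finite_Cartesian_Product.norm_nth_le)
  finally show ?thesis by (simp add: power_sum)
qed

lemma continuous_on_monom_n [continuous_intros]: "continuous_on S (monom_n j)"
  unfolding monom_n_def[abs_def] by (intro continuous_intros)

lemma continuous_on_gauss_dens [continuous_intros]: "continuous_on S (gauss_dens b)"
  unfolding gauss_dens_def[abs_def] by (intro continuous_intros)

lemma gauss_dens_pos: "b > 0 \<Longrightarrow> gauss_dens b z > 0"
  by (simp add: gauss_dens_def)

text \<open>A power of the monomial grows at most like \<open>exp (s * norm z)\<close>, with
  \<open>s\<close> equal to \<open>q\<close> times the degree, because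
  \<open>norm z \<le> exp (norm z)\<close>. Half of the Gaussian absorbs this by completing the
  square; the other half stays integrable.\<close>

lemma integrable_monom_n_powr_exp:
  fixes b q :: real and j :: "'n::finite \<Rightarrow> nat"
  assumes "b > 0" "q > 0"
  shows "integrable lborel (\<lambda>z::complex^'n. norm (monom_n j z) powr q * exp (- b * (norm z)\<^sup>2))"
proof (rule Bochner_Integration.integrable_bound)
  let ?s = "q * real (\<Sum>i\<in>UNIV. j i)"
  show "integrable lborel (\<lambda>z::complex^'n. exp (?s\<^sup>2 / (2 * b)) * exp (- (b/2) * (norm z)\<^sup>2))"
    using assms by (intro integrable_mult_right integrable_exp_minus_norm_squared) auto
  show "(\<lambda>z::complex^'n. norm (monom_n j z) powr q * exp (- b * (norm z)\<^sup>2)) \<in> borel_measurable lborel"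
    using assms by (auto intro!: borel_measurable_continuous_onI continuous_intros continuous_on_powr')
  have "norm (monom_n j z) powr q * exp (- b * (norm z)\<^sup>2)
      \<le> exp (?s\<^sup>2 / (2 * b)) * exp (- (b/2) * (norm z)\<^sup>2)" for z :: "complex^'n"
  proof -
    have "norm z \<le> exp (norm z)" using exp_ge_add_one_self[of "norm z"] by linarith
    then have "norm z ^ (\<Sum>i\<in>UNIV. j i) \<le> exp (norm z) ^ (\<Sum>i\<in>UNIV. j i)"
      by (intro power_mono) auto
    then have "norm (monom_n j z) \<le> exp (real (\<Sum>i\<in>UNIV. j i) * norm z)"
      using norm_monom_n_le[of j z] by (simp only: exp_of_nat_mult)
    then have "norm (monom_n j z) powr q \<le> exp (real (\<Sum>i\<in>UNIV. j i) * norm z) powr q"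
      using assms by (intro powr_mono2) auto
    also have "\<dots> = exp (?s * norm z)" by (simp add: powr_def mult_ac)
    finally have "norm (monom_n j z) powr q * exp (- b * (norm z)\<^sup>2)
        \<le> exp (?s * norm z) * exp (- b * (norm z)\<^sup>2)"
      by (rule mult_right_mono) simp
    also have "?s * norm z \<le> ?s\<^sup>2 / (2 * b) + b / 2 * (norm z)\<^sup>2"
    proof -
      have "0 \<le> (?s - b * norm z)\<^sup>2 / (2 * b)" using assms by simp
      also have "\<dots> = ?s\<^sup>2 / (2 * b) + b / 2 * (norm z)\<^sup>2 - ?s * norm z"
        using assms by (simp add: power2_eq_square field_simps)
      finally show ?thesis by simp
    qed
    then have "exp (?s * norm z) * exp (- b * (norm z)\<^sup>2) 
         \<le> exp (?s\<^sup>2 / (2 * b)) * exp (- (b/2) * (norm z)\<^sup>2)"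
      by (simp flip: exp_add)
    finally show ?thesis .
  qed
  then show "AE z::complex^'n in lborel. norm (norm (monom_n j z) powr q * exp (- b * (norm z)\<^sup>2))
      \<le> norm (exp (?s\<^sup>2 / (2 * b)) * exp (- (b/2) * (norm z)\<^sup>2))"
    by simp
qed

section \<open>Continuity, null sets and positivity of integrals\<close>

text \<open>The set where the functions agree is closed and has full measure, and a closed set of
  full measure is the whole space.\<close>

lemma AE_lborel_continuous_eq:
  fixes f g :: "'a::euclidean_space \<Rightarrow> 'b::real_normed_vector"
  assumes "AE x in lborel. f x = g x" "continuous_on UNIV f" "continuous_on UNIV g"
  shows "f = g"
proof
  fix x
  have "closed {x. f x = g x}"
    using assms by (intro closed_Collect_eq)
  moreover have "AE x in lebesgue. x \<in> {x. f x = g x}"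
    using assms(1) by (simp add: AE_completion)
  ultimately show "f x = g x"
    using mem_closed_if_AE_lebesgue by blast
qed

lemma integral_continuous_pos:
  fixes h :: "'a::euclidean_space \<Rightarrow> real"
  assumes "integrable lborel h" "continuous_on UNIV h" "\<And>z. h z \<ge> 0" "h y \<noteq> 0"
  shows "(\<integral>z. h z \<partial>lborel) > 0"
proof -
  have "(\<integral>z. h z \<partial>lborel) \<noteq> 0"
  proof
    assume "(\<integral>z. h z \<partial>lborel) = 0"
    then have "AE z in lborel. h z = 0"
      using assms by (simp add: integral_nonneg_eq_0_iff_AE)
    then have "h = (\<lambda>_. 0)"
      by (rule AE_lborel_continuous_eq) (use assms in auto)
    then show False using assms by simp
  qed
  moreover have "(\<integral>z. h z \<partial>lborel) \<ge> 0" using assms by simp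
  ultimately show ?thesis by linarith
qed

lemma continuous_on_norm_powr_gauss_dens:
  assumes "continuous_on UNIV (f :: complex^'n \<Rightarrow> complex)" "q > 0"
  shows "continuous_on UNIV (\<lambda>z. norm (f z) powr q * gauss_dens b z)"
  using assms by (intro continuous_intros continuous_on_powr') auto

text \<open>Without the normalising constants, which depend on the exponent, the Gaussians for
  \<open>a * p / 2\<close> and \<open>a * p' / 2\<close> are powers of one exponential, the form
  suited to Young's inequality.\<close>

lemma integrable_norm_powr_exp_iff:
  fixes f :: "complex^'n \<Rightarrow> complex"
  assumes "b > 0"
  shows "integrable lborel (\<lambda>z. norm (f z) powr q * gauss_dens b z)
     \<longleftrightarrow> integrable lborel (\<lambda>z. norm (f z) powr q * exp (- b * (norm z)\<^sup>2))"
proof -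
  have "(\<lambda>z. norm (f z) powr q * gauss_dens b z)
      = (\<lambda>z. (b / pi) ^ CARD('n) * (norm (f z) powr q * exp (- b * (norm z)\<^sup>2)))"
    by (simp add: gauss_dens_def fun_eq_iff)
  then show ?thesis using assms by simp
qed

lemma integrable_monom_n_powr_gauss_dens:
  fixes j :: "'n::finite \<Rightarrow> nat"
  assumes "b > 0" "q > 0"
  shows "integrable lborel (\<lambda>z::complex^'n. norm (monom_n j z) powr q * gauss_dens b z)"
  using integrable_norm_powr_exp_iff[of b "monom_n j" q] integrable_monom_n_powr_exp[of b q j] assms by simp

lemma monom_n_ones: "monom_n j (\<chi> i. 1) = 1"
  by (simp add: monom_n_def)

text \<open>Argued by measurability and not by continuity, since the exponent will be
  \<open>p - 2\<close>, which need not be positive.\<close>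

lemma borel_measurable_monom_n_powr_gauss_dens:
  "(\<lambda>z. norm (monom_n j z) powr q * gauss_dens b z) \<in> borel_measurable borel"
proof -
  have [measurable]: "monom_n j \<in> borel_measurable borel" "gauss_dens b \<in> borel_measurable (borel :: (complex^'a) measure)"
    by (auto intro!: borel_measurable_continuous_onI continuous_intros)
  show ?thesis by measurable
qed

lemma integral_monom_n_powr_pos:
  fixes j :: "'n::finite \<Rightarrow> nat"
  assumes "b > 0" "q > 0"
  shows "(\<integral>z. norm (monom_n j (z::complex^'n)) powr q * gauss_dens b z \<partial>lborel) > 0"
proof (rule integral_continuous_pos[where y = "\<chi> i. 1"])
  show "continuous_on UNIV (\<lambda>z::complex^'n. norm (monom_n j z) powr q * gauss_dens b z)"
    using assms by (intro continuous_on_norm_powr_gauss_dens continuous_intros)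
  show "norm (monom_n j (\<chi> i. 1)) powr q * gauss_dens b ((\<chi> i. 1) :: complex^'n) \<noteq> 0"
    using gauss_dens_pos[OF assms(1), of "(\<chi> i. 1) :: complex^'n"] by (simp add: monom_n_ones)
  show "norm (monom_n j z) powr q * gauss_dens b z \<ge> 0" for z :: "complex^'n"
    using gauss_dens_pos[OF assms(1), of z] by simp
qed (use assms integrable_monom_n_powr_gauss_dens in auto)

section \<open>Integrability of the two pairings with the monomial\<close>

lemma fock_space_entire: "f \<in> fock_space p a \<Longrightarrow> entire_n f"
  by (simp add: fock_space_def)

lemma integrable_fock_space:
  "f \<in> fock_space p a \<Longrightarrow> integrable lborel (\<lambda>z. norm (f z) powr p * gauss_dens (a * p / 2) z)"
  by (simp add: fock_space_def)

text \<open>Young's inequality after splitting the Gaussian into two equal square roots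
  \<open>?e\<close>, one for each factor; their powers \<open>p\<close> and \<open>p'\<close> are
  the Gaussians of the two norms.\<close>

lemma integrable_fock_inner_monom_n:
  fixes f :: "complex^'n \<Rightarrow> complex"
  assumes "a > 0" "p > 1" "p' > 1" "1 / p + 1 / p' = 1" "f \<in> fock_space p a" "continuous_on UNIV f"
  shows "integrable lborel (\<lambda>z. f z * cnj (monom_n j z) * of_real (gauss_dens a z))"
proof (rule Bochner_Integration.integrable_bound)
  let ?K = "(a / pi) ^ CARD('n)"
  let ?B = "\<lambda>z. ?K * (norm (f z) powr p * exp (- (a * p / 2) * (norm z)\<^sup>2)
      + norm (monom_n j z) powr p' * exp (- (a * p' / 2) * (norm z)\<^sup>2))"
  have "integrable lborel (\<lambda>z. norm (f z) powr p * exp (- (a * p / 2) * (norm z)\<^sup>2))"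
    using assms integrable_fock_space[OF assms(5)] integrable_norm_powr_exp_iff[of "a * p / 2" f p] by simp
  moreover have "integrable lborel (\<lambda>z::complex^'n. norm (monom_n j z) powr p' * exp (- (a * p' / 2) * (norm z)\<^sup>2))"
    using assms by (intro integrable_monom_n_powr_exp) auto
  ultimately show "integrable lborel ?B"
    by (intro integrable_mult_right Bochner_Integration.integrable_add)
  show "(\<lambda>z. f z * cnj (monom_n j z) * of_real (gauss_dens a z)) \<in> borel_measurable lborel"
    using assms by (auto intro!: borel_measurable_continuous_onI continuous_intros)
  have "norm (f z * cnj (monom_n j z) * of_real (gauss_dens a z)) \<le> ?B z" for z
  proof -
    let ?e = "exp (- (a / 2) * (norm z)\<^sup>2)"
    have ep: "?e powr q = exp (- (a * q / 2) * (norm z)\<^sup>2)" for q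
      by (simp add: powr_def mult_ac)
    have "(norm (f z) * ?e) * (norm (monom_n j z) * ?e)
        \<le> (norm (f z) * ?e) powr p / p + (norm (monom_n j z) * ?e) powr p' / p'"
      using assms by (intro Youngs_inequality) auto
    also have "\<dots> \<le> (norm (f z) * ?e) powr p + (norm (monom_n j z) * ?e) powr p'"
      using assms by (intro add_mono) (auto simp: divide_le_eq mult_le_cancel_left1)
    also have "\<dots> = norm (f z) powr p * exp (- (a * p / 2) * (norm z)\<^sup>2)
      + norm (monom_n j z) powr p' * exp (- (a * p' / 2) * (norm z)\<^sup>2)"
      unfolding ep[symmetric] by (simp add: powr_mult)
    finally have "?K * ((norm (f z) * ?e) * (norm (monom_n j z) * ?e)) \<le> ?B z"
      using assms by (intro mult_left_mono) auto
    moreover have "?e * ?e = exp (- a * (norm z)\<^sup>2)"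
      by (simp flip: exp_add)
    then have "norm (f z) * norm (monom_n j z) * gauss_dens a z
        = ?K * ((norm (f z) * ?e) * (norm (monom_n j z) * ?e))"
      by (simp add: gauss_dens_def mult_ac)
    moreover have "norm (f z * cnj (monom_n j z) * of_real (gauss_dens a z))
        = norm (f z) * norm (monom_n j z) * gauss_dens a z"
      using gauss_dens_pos[OF assms(1), of z] by (simp add: norm_mult)
    ultimately show ?thesis by (simp only:)
  qed
  then have "norm (f z * cnj (monom_n j z) * of_real (gauss_dens a z)) \<le> norm (?B z)" for z
    by (rule order_trans) simp
  then show "AE z in lborel. norm (f z * cnj (monom_n j z) * of_real (gauss_dens a z)) \<le> norm (?B z)"
    by simp
qed

text \<open>At \<open>x = 0\<close> both sides vanish for every \<open>p\<close>, because
  \<open>0 powr p = 0\<close>.\<close>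

lemma powr_mult_power2: "0 \<le> x \<Longrightarrow> x\<^sup>2 * x powr (p - 2) = x powr p" for x p :: real
  by (cases "x = 0") (simp_all add: powr_diff)

text \<open>Here both factors share one Gaussian. Young's inequality is applied to
  \<open>norm (f z)\<close> and the power \<open>p - 1\<close> of the monomial, whose
  \<open>p'\<close>-th power is the \<open>p\<close>-th power since
  \<open>(p - 1) * p' = p\<close>.\<close>

lemma integrable_fock_space_dual_monom_n:
  fixes f :: "complex^'n \<Rightarrow> complex"
  assumes "a > 0" "p > 1" "p' > 1" "1 / p + 1 / p' = 1" "f \<in> fock_space p a" "continuous_on UNIV f"
  shows "integrable lborel (\<lambda>z. f z * cnj (monom_n j z) *
      of_real (norm (monom_n j z) powr (p - 2) * gauss_dens (a * p / 2) z))"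
proof (rule Bochner_Integration.integrable_bound)
  let ?g = "gauss_dens (a * p / 2) :: complex^'n \<Rightarrow> real"
  let ?B = "\<lambda>z. norm (f z) powr p * ?g z + norm (monom_n j z) powr p * ?g z"
  have g: "?g z > 0" for z using assms by (intro gauss_dens_pos) auto
  show "integrable lborel ?B"
    using assms by (intro Bochner_Integration.integrable_add integrable_fock_space integrable_monom_n_powr_gauss_dens) auto
  have "(\<lambda>z. f z * cnj (monom_n j z)) \<in> borel_measurable borel"
    by (intro borel_measurable_continuous_onI continuous_intros assms(6))
  moreover have "(\<lambda>z. complex_of_real (norm (monom_n j z) powr (p - 2) * ?g z)) \<in> borel_measurable borel"
    by (rule measurable_compose[OF borel_measurable_monom_n_powr_gauss_dens])
       (intro borel_measurable_continuous_onI continuous_intros)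
  ultimately show "(\<lambda>z. f z * cnj (monom_n j z) *
      of_real (norm (monom_n j z) powr (p - 2) * ?g z)) \<in> borel_measurable lborel"
    using borel_measurable_times by simp
  have "norm (f z * cnj (monom_n j z) * of_real (norm (monom_n j z) powr (p - 2) * ?g z)) \<le> ?B z" for z
  proof -
    let ?x = "norm (f z)" and ?y = "norm (monom_n j z)"
    have y: "?y * ?y powr (p - 2) = ?y powr (p - 1)"
      by (cases "monom_n j z = 0") (simp_all add: powr_diff field_simps power2_eq_square)
    have "(p - 1) * p' = p"
      using assms by (simp add: field_simps)
    then have yp: "(?y powr (p - 1)) powr p' = ?y powr p" by (simp add: powr_powr)
    have "?x * ?y powr (p - 1) \<le> ?x powr p / p + (?y powr (p - 1)) powr p' / p'"
      using assms by (intro Youngs_inequality) auto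
    also have "\<dots> \<le> ?x powr p + ?y powr p"
      unfolding yp using assms by (intro add_mono) (auto simp: divide_le_eq mult_le_cancel_left1)
    finally have "?x * ?y powr (p - 1) * ?g z \<le> (?x powr p + ?y powr p) * ?g z"
      using g[of z] by (intro mult_right_mono) auto
    moreover have "norm (f z * cnj (monom_n j z) * of_real (?y powr (p - 2) * ?g z)) = ?x * ?y powr (p - 1) * ?g z"
      using g[of z] by (simp add: norm_mult flip: y)
    ultimately show ?thesis by (simp add: distrib_right)
  qed
  then have "norm (f z * cnj (monom_n j z) * of_real (norm (monom_n j z) powr (p - 2) * ?g z)) \<le> norm (?B z)" for z
    by (rule order_trans) simp
  then show "AE z in lborel. norm (f z * cnj (monom_n j z) *
      of_real (norm (monom_n j z) powr (p - 2) * ?g z)) \<le> norm (?B z)"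
    by simp
qed

section \<open>The extremal property\<close>

text \<open>Strict convexity through the mean value theorem between \<open>t\<close> and 1: the
  slope \<open>p * x powr (p - 1)\<close> is below \<open>p\<close> left of 1 and above
  \<open>p\<close> right of it.\<close>

lemma powr_gt_tangent:
  fixes t p :: real
  assumes "t \<ge> 0" "t \<noteq> 1" "p > 1"
  shows "t powr p > 1 + p * (t - 1)"
proof -
  have der: "((\<lambda>x. x powr p) has_real_derivative p * x powr (p - 1)) (at x)" if "x > 0" for x
    using that by (auto intro!: derivative_eq_intros)
  consider "t = 0" | "0 < t" "t < 1" | "t > 1" using assms by linarith
  then show ?thesis
  proof cases
    case 1 then show ?thesis using assms by simp
  next
    case 2
    then obtain x where x: "t < x" "x < 1" "1 powr p - t powr p = (1 - t) * (p * x powr (p - 1))"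
      using MVT2[of t 1 "\<lambda>x. x powr p" "\<lambda>x. p * x powr (p - 1)"] der by force
    have "x powr (p - 1) < 1 powr (p - 1)"
      using x 2 assms by (intro powr_less_mono2) auto
    then have "(1 - t) * (p * x powr (p - 1)) < (1 - t) * (p * 1)"
      using 2 assms by (intro mult_strict_left_mono) auto
    then show ?thesis using x by (simp add: algebra_simps)
  next
    case 3
    then obtain x where x: "1 < x" "x < t" "t powr p - 1 powr p = (t - 1) * (p * x powr (p - 1))"
      using MVT2[of 1 t "\<lambda>x. x powr p" "\<lambda>x. p * x powr (p - 1)"] der by force
    have "1 powr (p - 1) < x powr (p - 1)"
      using x 3 assms by (intro powr_less_mono2) auto
    then have "(t - 1) * (p * x powr (p - 1)) > (t - 1) * (p * 1)"
      using 3 assms by (intro mult_strict_left_mono) auto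
    then show ?thesis using x by (simp add: algebra_simps)
  qed
qed

text \<open>Scaling by the modulus of \<open>v\<close> reduces to \<open>powr_gt_tangent\<close> at
  \<open>t = norm u / norm v\<close>. Strictness comes from convexity if
  \<open>t \<noteq> 1\<close>; if \<open>t = 1\<close>, distinct points of one circle satisfy
  \<open>Re (u * cnj v) < (norm v)\<^sup>2\<close>. For \<open>v = 0\<close> the right side is
  0.\<close>

lemma norm_powr_gt_tangent:
  fixes u v :: complex and p :: real
  assumes "p > 1" "u \<noteq> v"
  shows "norm u powr p > norm v powr p + p * norm v powr (p - 2) * (Re (u * cnj v) - (norm v)\<^sup>2)"
proof (cases "v = 0")
  case True
  then show ?thesis using assms by simp
next
  case False
  define Y where "Y = norm v"
  define t where "t = norm u / Y"
  have Y: "Y > 0" and t: "t \<ge> 0" using False by (auto simp: Y_def t_def)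
  have u: "norm u = t * Y" using Y by (simp add: t_def)
  have pw: "Y powr p = Y powr (p - 2) * Y\<^sup>2"
    using Y by (simp add: powr_diff)
  have re: "Re (u * cnj v) \<le> t * Y\<^sup>2"
    using complex_Re_le_cmod[of "u * cnj v"] by (simp add: norm_mult u Y_def[symmetric] power2_eq_square)
  have up: "norm u powr p = t powr p * (Y powr (p - 2) * Y\<^sup>2)"
    unfolding u using Y t by (simp add: powr_mult pw)
  have pos: "Y powr (p - 2) * Y\<^sup>2 > 0" "p * Y powr (p - 2) > 0" using Y assms by auto
  have le: "p * Y powr (p - 2) * (Re (u * cnj v) - Y\<^sup>2) \<le> p * Y powr (p - 2) * (t * Y\<^sup>2 - Y\<^sup>2)"
    using pos re by (intro mult_left_mono) auto
  have eq: "Y powr p + p * Y powr (p - 2) * (t * Y\<^sup>2 - Y\<^sup>2) = (1 + p * (t - 1)) * (Y powr (p - 2) * Y\<^sup>2)"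
    by (simp add: pw algebra_simps)
  show ?thesis
  proof (cases "t = 1")
    case False
    then have "(1 + p * (t - 1)) * (Y powr (p - 2) * Y\<^sup>2) < t powr p * (Y powr (p - 2) * Y\<^sup>2)"
      using powr_gt_tangent[OF t False assms(1)] pos by (intro mult_strict_right_mono) auto
    then show ?thesis using le eq up by (simp flip: Y_def)
  next
    case True
    have "(norm (u - v))\<^sup>2 = (norm u)\<^sup>2 + (norm v)\<^sup>2 - 2 * Re (u * cnj v)"
      unfolding cmod_power2 by (simp add: power2_eq_square algebra_simps)
    moreover have "(norm (u - v))\<^sup>2 > 0" using assms by simp
    ultimately have "Re (u * cnj v) < Y\<^sup>2" using u True by (simp add: Y_def)
    then have "p * Y powr (p - 2) * (Re (u * cnj v) - Y\<^sup>2) < 0"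
      using pos by (intro mult_pos_neg) auto
    then show ?thesis using up pw True by (simp flip: Y_def)
  qed
qed

section \<open>Comparison of a function with its monomial part\<close>

lemma fock_space_coefficient:
  fixes f :: "complex^'n \<Rightarrow> complex"
  assumes "a > 0" "p > 1" "p' > 1" "1 / p + 1 / p' = 1" and f: "f \<in> fock_space p a"
  defines "N \<equiv> \<lambda>h::complex^'n \<Rightarrow> complex. \<integral>z. norm (h z) powr p * gauss_dens (a * p / 2) z \<partial>lborel"
  obtains c where
    "fock_inner a f (monom_n j) = c * fock_inner a (monom_n j) (monom_n j)"
    "norm c powr p * N (monom_n j) \<le> N f"
    "norm c powr p * N (monom_n j) = N f \<longrightarrow> f = (\<lambda>z. c * monom_n j z)"
proof -
  let ?m = "monom_n j :: complex^'n \<Rightarrow> complex" and ?g = "gauss_dens (a * p / 2) :: complex^'n \<Rightarrow> real"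
  have ent: "entire_n f" using f by (rule fock_space_entire)
  then have cont: "continuous_on UNIV f" by (rule entire_n_continuous)
  have g: "?g z > 0" for z using assms by (intro gauss_dens_pos) auto
  obtain c where c: "\<And>w. \<lbrakk>w \<in> borel_measurable borel; \<And>k t z. w (rot k t z) = w z;
      integrable lborel (\<lambda>z. f z * cnj (?m z) * of_real (w z))\<rbrakk>
    \<Longrightarrow> (\<integral>z. f z * cnj (?m z) * of_real (w z) \<partial>lborel)
          = c * of_real (\<integral>z. (norm (?m z))\<^sup>2 * w z \<partial>lborel)"
    using integral_entire_n_cnj_monom_n[OF ent] by blast
  have gauss_rot: "gauss_dens b (rot k t z) = gauss_dens b z" for b k t and z :: "complex^'n"
    by (simp add: gauss_dens_def)
  have inner_m: "fock_inner a ?m ?m = of_real (\<integral>z. (norm (?m z))\<^sup>2 * gauss_dens a z \<partial>lborel)"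
    unfolding fock_inner_def
    by (simp add: complex_norm_square[symmetric] del: of_real_power flip: of_real_power of_real_mult)
  have inner_eq: "fock_inner a f ?m = c * fock_inner a ?m ?m"
    unfolding inner_m unfolding fock_inner_def
    using integrable_fock_inner_monom_n[OF assms(1-5) cont]
    by (intro c gauss_rot) (auto intro!: borel_measurable_continuous_onI continuous_intros)
  let ?\<Phi> = "\<lambda>z. f z * cnj (?m z) * of_real (norm (?m z) powr (p - 2) * ?g z)"
  have int\<Phi>: "integrable lborel ?\<Phi>"
    by (rule integrable_fock_space_dual_monom_n[OF assms(1-5) cont])
  have "(\<integral>z. ?\<Phi> z \<partial>lborel) = c * of_real (\<integral>z. (norm (?m z))\<^sup>2 * (norm (?m z) powr (p - 2) * ?g z) \<partial>lborel)"
  proof (rule c)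
    show "(\<lambda>z. norm (?m z) powr (p - 2) * ?g z) \<in> borel_measurable borel"
      by (rule borel_measurable_monom_n_powr_gauss_dens)
    show "norm (?m (rot k t z)) powr (p - 2) * ?g (rot k t z) = norm (?m z) powr (p - 2) * ?g z" for k t z
      by (simp add: monom_n_rot gauss_rot norm_mult)
  qed (rule int\<Phi>)
  then have \<Phi>: "(\<integral>z. ?\<Phi> z \<partial>lborel) = c * of_real (N ?m)"
    unfolding N_def by (simp only: mult.assoc[symmetric] powr_mult_power2[OF norm_ge_zero])
  \<comment> \<open>The gap in \<open>norm_powr_gt_tangent\<close> at \<open>u = f z\<close> and
    \<open>v = c * ?m z\<close>, times the Gaussian, expanded into terms that can be integrated
    separately.\<close>
  define D where "D z = norm (f z) powr p * ?g z - norm c powr p * (norm (?m z) powr p * ?g z)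
      - p * (norm c powr (p - 2) * Re (cnj c * ?\<Phi> z) - norm c powr p * (norm (?m z) powr p * ?g z))" for z
  have D_eq: "D z = (norm (f z) powr p - (norm (c * ?m z) powr p +
      p * norm (c * ?m z) powr (p - 2) * (Re (f z * cnj (c * ?m z)) - (norm (c * ?m z))\<^sup>2))) * ?g z" for z
  proof -
    have 1: "norm (c * ?m z) powr q = norm c powr q * norm (?m z) powr q" for q
      by (simp add: norm_mult powr_mult)
    have 2: "norm (c * ?m z) powr (p - 2) * (norm (c * ?m z))\<^sup>2 = norm c powr p * norm (?m z) powr p"
      using powr_mult_power2[of "norm (c * ?m z)" p] by (simp add: 1 mult.commute)
    have 3: "Re (cnj c * ?\<Phi> z) = Re (f z * cnj (c * ?m z)) * (norm (?m z) powr (p - 2) * ?g z)"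
    proof -
      have "cnj c * ?\<Phi> z = f z * cnj (c * ?m z) * of_real (norm (?m z) powr (p - 2) * ?g z)"
        by (simp add: mult_ac)
      then show ?thesis by (simp only: Re_complex_of_real times_complex.sel complex_of_real_def complex.sel mult_zero_right diff_zero)
    qed
    have "D z = (norm (f z) powr p - (norm (c * ?m z) powr p +
      p * (norm (c * ?m z) powr (p - 2) * Re (f z * cnj (c * ?m z))
       - norm (c * ?m z) powr (p - 2) * (norm (c * ?m z))\<^sup>2))) * ?g z"
      unfolding D_def 2 3 unfolding 1 by (simp add: algebra_simps)
    then show ?thesis by (simp only: right_diff_distrib mult.assoc)
  qed
  have D_pos: "D z > 0" if "f z \<noteq> c * ?m z" for z
    unfolding D_eq using norm_powr_gt_tangent[OF assms(2) that] g[of z] by (intro mult_pos_pos) auto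
  have D_0: "D z = 0" if "f z = c * ?m z" for z
  proof -
    have "Re (v * cnj v) = (norm v)\<^sup>2" for v
      unfolding cmod_power2 by (simp add: power2_eq_square)
    then show ?thesis
      unfolding D_eq that by (simp only: diff_self mult_zero_right mult_zero_left add_0_right)
  qed
  have D_ge: "D z \<ge> 0" for z
    using D_pos[of z] D_0[of z] by (cases "f z = c * ?m z") auto
  have intf: "integrable lborel (\<lambda>z. norm (f z) powr p * ?g z)"
    by (rule integrable_fock_space[OF f])
  have intm: "integrable lborel (\<lambda>z. norm (?m z) powr p * ?g z)"
    using assms by (intro integrable_monom_n_powr_gauss_dens) auto
  have intD: "integrable lborel D"
    unfolding D_def[abs_def]
    by (intro Bochner_Integration.integrable_diff integrable_mult_right integrable_Re intf intm int\<Phi>)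
  \<comment> \<open>As \<open>?\<Phi>\<close> integrates to \<open>c * N ?m\<close>, the pairing
    contributes \<open>norm c powr p * N ?m\<close>, and the bracket after the factor
    \<open>p\<close> vanishes.\<close>
  have "(\<integral>z. D z \<partial>lborel) = N f - norm c powr p * N ?m
      - p * (norm c powr (p - 2) * Re (cnj c * (\<integral>z. ?\<Phi> z \<partial>lborel)) - norm c powr p * N ?m)"
    unfolding D_def[abs_def] N_def
    using intf intm int\<Phi> integrable_mult_right[OF int\<Phi>, of "cnj c"]
    by (simp add: integral_Re del: times_complex.sel of_real_mult)
  also have "Re (cnj c * (\<integral>z. ?\<Phi> z \<partial>lborel)) = (norm c)\<^sup>2 * N ?m"
    unfolding \<Phi> cmod_power2 by (simp add: power2_eq_square algebra_simps)
  also have "norm c powr (p - 2) * ((norm c)\<^sup>2 * N ?m) = norm c powr p * N ?m"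
    using powr_mult_power2[of "norm c" p] by (metis mult.assoc mult.commute norm_ge_zero)
  finally have intD_eq: "(\<integral>z. D z \<partial>lborel) = N f - norm c powr p * N ?m" by simp
  have le: "norm c powr p * N ?m \<le> N f"
    using Bochner_Integration.integral_nonneg[of lborel D] D_ge intD_eq by simp
  have eq: "f = (\<lambda>z. c * ?m z)" if "norm c powr p * N ?m = N f"
  proof -
    \<comment> \<open>Equality of norms makes the integral of the nonnegative \<open>D\<close> zero;
      strictness of the tangent inequality then gives \<open>f = c * ?m\<close> almost everywhere,
      and continuity everywhere.\<close>
    have "AE z in lborel. D z = 0"
      using that intD_eq intD D_ge by (simp flip: integral_nonneg_eq_0_iff_AE)
    then have "AE z in lborel. f z = c * ?m z"
      by eventually_elim (use D_pos in force)
    then show ?thesis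
      by (rule AE_lborel_continuous_eq) (intro cont continuous_intros)+
  qed
  show thesis by (rule that[OF inner_eq le impI[OF eq]])
qed

lemma fock_inner_monom_n_nonzero:
  fixes j :: "'n::finite \<Rightarrow> nat"
  assumes "a > 0"
  shows "fock_inner a (monom_n j) (monom_n j :: complex^'n \<Rightarrow> complex) \<noteq> 0"
proof -
  have "monom_n j z * cnj (monom_n j z) * of_real (gauss_dens a z)
      = of_real (norm (monom_n j z) powr 2 * gauss_dens a z)" for z :: "complex^'n"
    using complex_norm_square[of "monom_n j z"] by simp
  then have "fock_inner a (monom_n j) (monom_n j)
      = of_real (\<integral>z. norm (monom_n j (z :: complex^'n)) powr 2 * gauss_dens a z \<partial>lborel)"
    unfolding fock_inner_def by (simp only: integral_complex_of_real)
  then show ?thesis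
    using integral_monom_n_powr_pos[OF assms, of 2 j] by simp
qed

theorem theorem4p4:
  fixes f :: "complex^'n \<Rightarrow> complex"
    and j :: "'n \<Rightarrow> nat"
    and a p p' :: real
  assumes "a > 0" and "1 < p" and "1 / p + 1 / p' = 1"
    and "f \<in> fock_space p a" and "f \<noteq> (\<lambda>_. 0)"
  shows "norm (fock_inner a f (monom_n j)) / fock_norm p a f
           \<le> norm (fock_inner a (monom_n j) (monom_n j)) / fock_norm p a (monom_n j)
    \<and> fock_R p p' a f (monom_n j) \<le> fock_R p p' a (monom_n j) (monom_n j)
    \<and> ((norm (fock_inner a f (monom_n j)) / fock_norm p a f
           = norm (fock_inner a (monom_n j) (monom_n j)) / fock_norm p a (monom_n j))
         \<longleftrightarrow> (\<exists>c. f = (\<lambda>z. c * monom_n j z)))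
    \<and> ((fock_R p p' a f (monom_n j) = fock_R p p' a (monom_n j) (monom_n j))
         \<longleftrightarrow> (\<exists>c. f = (\<lambda>z. c * monom_n j z)))"
proof -
  let ?m = "monom_n j :: complex^'n \<Rightarrow> complex"
  define N where "N h = (\<integral>z. norm (h z) powr p * gauss_dens (a * p / 2) z \<partial>lborel)"
    for h :: "complex^'n \<Rightarrow> complex"
  \<comment> \<open>\<open>1 / p'\<close> lies strictly between 0 and 1. This also excludes
    \<open>p' = 0\<close>, where \<open>1 / p'\<close> would be 0.\<close>
  have p': "p' > 1"
  proof -
    have "1 / p < 1" "1 / p > 0" using assms by auto
    then have "1 / p' > 0" "1 / p' < 1" using assms(3) by linarith+
    then show ?thesis by (simp add: divide_less_eq split: if_splits)
  qed
  obtain c where c: "fock_inner a f ?m = c * fock_inner a ?m ?m"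
    and le: "norm c powr p * N ?m \<le> N f"
    and eq: "norm c powr p * N ?m = N f \<longrightarrow> f = (\<lambda>z. c * ?m z)"
    unfolding N_def by (rule fock_space_coefficient[OF assms(1,2) p' assms(3,4), of j])
  define I where "I = norm (fock_inner a ?m ?m)"
  define x where "x = fock_norm p a f"
  define y where "y = fock_norm p a ?m"
  define q where "q = fock_norm p' a ?m"
  have I: "I > 0" using fock_inner_monom_n_nonzero[OF assms(1), of j] by (simp add: I_def)
  have Nm: "N ?m > 0"
    unfolding N_def using assms by (intro integral_monom_n_powr_pos) auto
  have q: "q > 0"
    unfolding q_def fock_norm_def using integral_monom_n_powr_pos[of "a * p' / 2" p' j] assms p' by simp
  have Nf: "N f > 0"
  proof -
    obtain z where "f z \<noteq> 0" using assms(5) by auto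
    moreover have "gauss_dens (a * p / 2) z > 0" for z :: "complex^'n"
      using assms by (intro gauss_dens_pos) auto
    ultimately show ?thesis
      unfolding N_def
      using assms entire_n_continuous[OF fock_space_entire[OF assms(4)]]
      by (intro integral_continuous_pos[where y = z] integrable_fock_space continuous_on_norm_powr_gauss_dens)
         (auto simp: less_imp_le less_imp_neq[symmetric])
  qed
  have x: "x = N f powr (1 / p)" and y: "y = N ?m powr (1 / p)"
    by (simp_all add: x_def y_def fock_norm_def N_def)
  have xy: "x > 0" "y > 0" using Nf Nm by (auto simp: x y)
  have xp: "x powr p = N f" and yp: "y powr p = N ?m"
    using Nf Nm assms by (simp_all add: x y powr_powr)
  have cy: "(norm c * y) powr p = norm c powr p * N ?m"
    using xy by (simp add: powr_mult yp)
  have cy_le: "norm c * y \<le> x"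
  proof (rule ccontr)
    assume "\<not> norm c * y \<le> x"
    then have "x powr p < (norm c * y) powr p"
      using xy assms by (intro powr_less_mono2) auto
    then show False using le by (simp add: cy xp)
  qed
  have ex_iff: "x = norm c * y \<longleftrightarrow> (\<exists>c. f = (\<lambda>z. c * ?m z))"
  proof
    assume "x = norm c * y"
    then have "norm c powr p * N ?m = N f" using cy xp by simp
    then show "\<exists>c. f = (\<lambda>z. c * ?m z)" using eq by blast
  next
    assume "\<exists>c. f = (\<lambda>z. c * ?m z)"
    then obtain d where d: "f = (\<lambda>z. d * ?m z)" by blast
    have "fock_inner a f ?m = d * fock_inner a ?m ?m"
      unfolding fock_inner_def d by (simp add: mult.assoc)
    \<comment> \<open>The inner product of the monomial with itself is nonzero, so the given
      multiple must be the coefficient \<open>c\<close>.\<close>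
    then have "d = c" using c I by (simp add: I_def)
    moreover have "N f = norm d powr p * N ?m"
      unfolding N_def d by (simp add: norm_mult powr_mult mult.assoc)
    ultimately have "(norm c * y) powr p = x powr p" by (simp add: cy xp)
    then show "x = norm c * y"
      using cy_le powr_less_mono2[of p "norm c * y" x] xy assms(2) by fastforce
  qed
  \<comment> \<open>Both quotients become multiples of \<open>I / y > 0\<close>, so all claims
    reduce to comparing \<open>norm c * y / x\<close> with 1.\<close>
  have L: "norm (fock_inner a f ?m) / x = norm c * y / x * (I / y)"
    using xy by (simp add: c norm_mult I_def)
  have R: "norm (fock_inner a ?m ?m) / y = 1 * (I / y)" by (simp add: I_def)
  have Iy: "I / y > 0" using I xy by simp
  have main: "norm (fock_inner a f ?m) / x \<le> norm (fock_inner a ?m ?m) / y"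
    unfolding L R using cy_le xy Iy by (intro mult_right_mono) auto
  have main_iff: "norm (fock_inner a f ?m) / x = norm (fock_inner a ?m ?m) / y
      \<longleftrightarrow> (\<exists>c. f = (\<lambda>z. c * ?m z))"
    unfolding L R mult_cancel_right using ex_iff xy I by simp
  \<comment> \<open>The ratios differ from the quotients by the common positive divisor
    \<open>q\<close>, so inequality and equality carry over.\<close>
  have "fock_R p p' a f ?m = norm (fock_inner a f ?m) / x / q"
    "fock_R p p' a ?m ?m = norm (fock_inner a ?m ?m) / y / q"
    by (simp_all add: fock_R_def x_def y_def q_def)
  then have "fock_R p p' a f ?m \<le> fock_R p p' a ?m ?m"
    "(fock_R p p' a f ?m = fock_R p p' a ?m ?m) \<longleftrightarrow> (\<exists>c. f = (\<lambda>z. c * ?m z))"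
    using main main_iff q by (simp_all add: divide_le_cancel del: divide_divide_eq_left)
  then show ?thesis
    using main main_iff unfolding x_def y_def by blast
qed

end
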